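(* Let $k\in\mathbb Z$, $N\in\mathbb N$, and let $f\in S_k^!(N)$. Then for each $s\in\mathbb R$ and each $w\in\mathbb C$ with $\operatorname{Im}(w)>0$ we have $$L_f(\varphi_s^w)=i^{-s}\int_{i}^{i+1} f(z)\,e^{iwz}\,\zeta\left(1-s,\frac{w}{2\pi},z\right)dz .$$
   Context: $S_k^!(N)$ is the space of weakly holomorphic cusp forms of weight $k$ for $\Gamma_0(N)$, i.e. weakly holomorphic modular forms of weight $k$ for $\Gamma_0(N)$ (holomorphic on the upper half-plane $\mathbb H$, meromorphic at the cusps) with vanishing constant terms at all cusps. Such $f$ has a Fourier expansion $f(z)=\sum_{n\ge -n_0,\ n\neq 0}a_f(n)e^{2\pi i n z}$ for some $n_0\in\mathbb N$. For $s,w\in\mathbb C$, $\varphi_s^w(t):=\mathbf 1_{[1,\infty)}(t)\,e^{-wt}t^{s-1}$ for $t>0$, where $\mathbf 1_S$ is the characteristic function of $S$. The $L$-series is $L_f(\varphi_s^w):=\sum_{n\ge -n_0,\ n\ne 0}a_f(n)(\mathcal L\varphi_s^w)(2\pi n)$, where $(\mathcal L\varphi)(u)=\int_0^\infty e^{-ut}\varphi(t)\,dt$. Here $(\mathcal L\varphi_s^w)(2\pi n)=E_{1-s}(2\pi n+w)$ whenever $\operatorname{Re}(2\pi n+w)>0$, where $E_s(z)=\int_1^\infty e^{-zt}t^{-s}dt$ for $\operatorname{Re}(z)>0$, continued analytically in $z$ to $\mathbb C\setminus(-\infty,0]$ (principal branch). For general $w$ with $\operatorname{Im}(w)>0$,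 $L_f(\varphi_s^w)$ is understood by analytic continuation in $w$, i.e. $L_f(\varphi_s^w)=\sum_{n\ge -n_0,\ n\neq0}a_f(n)E_{1-s}(2\pi n+w)$. $\zeta(s,a,z):=\sum_{m=0}^\infty e^{2\pi i m a}(z+m)^{-s}$ is the Lerch zeta function. All powers use the principal branch of the logarithm (so $i^{-s}=e^{-\pi i s/2}$), and the integral is along the horizontal segment from $i$ to $i+1$. *)

theory Defs
  imports "HOL-Complex_Analysis.Complex_Analysis"
begin

section \<open>Weakly holomorphic cusp forms\<close>

definition upper_half_plane :: "complex set" where
  "upper_half_plane = {z. Im z > 0}"

definition SL2Z :: "(int^2^2) set" where
  "SL2Z = {A. det A = 1}"

definition Gamma0 :: "nat \<Rightarrow> (int^2^2) set" where
  "Gamma0 N = {A \<in> SL2Z. int N dvd A $ 2 $ 1}"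

definition slash :: "int \<Rightarrow> int^2^2 \<Rightarrow> (complex \<Rightarrow> complex) \<Rightarrow> complex \<Rightarrow> complex" where
  "slash k A f z =
     (of_int (A $ 2 $ 1) * z + of_int (A $ 2 $ 2)) powi (- k) *
     f ((of_int (A $ 1 $ 1) * z + of_int (A $ 1 $ 2)) / (of_int (A $ 2 $ 1) * z + of_int (A $ 2 $ 2)))"

text \<open>\<open>q_expansion h g a\<close>: on the upper half-plane, \<open>g\<close> is the sum of its Fourier series of period
  \<open>h\<close> with coefficients \<open>a\<close>, of which only finitely many with negative index are non-zero.\<close>

definition q_expansion :: "nat \<Rightarrow> (complex \<Rightarrow> complex) \<Rightarrow> (int \<Rightarrow> complex) \<Rightarrow> bool" where
  "q_expansion h g a \<longleftrightarrow>
     (\<exists>n0::nat. \<forall>n < - int n0. a n = 0) \<and>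
     (\<forall>z\<in>upper_half_plane.
        ((\<lambda>n. a n * exp (2 * of_real pi * \<i> * of_int n * z / of_nat h)) has_sum g z) UNIV)"

text \<open>The cusps are the points \<open>A \<infinity>\<close> for \<open>A\<close> in \<open>SL2Z\<close>. Conjugating \<open>Gamma0 N\<close> by \<open>A\<close>
  gives a group that contains the translation by \<open>N\<close> (the width of every cusp divides \<open>N\<close>), so
  \<open>slash k A f\<close> has period \<open>N\<close>; neither the meromorphy at a cusp nor the constant term depends on
  whether one expands with respect to \<open>N\<close> or to the exact width. Forms are functions on all of
  the complex plane of which only the values on the upper half-plane matter.\<close>

definition weakly_holomorphic_forms :: "int \<Rightarrow> nat \<Rightarrow> (complex \<Rightarrow> complex) set" where
  "weakly_holomorphic_forms k N =
     {f. f holomorphic_on upper_half_plane \<and>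
         (\<forall>A\<in>Gamma0 N. \<forall>z\<in>upper_half_plane. slash k A f z = f z) \<and>
         (\<forall>A\<in>SL2Z. \<exists>a. q_expansion N (slash k A f) a)}"

definition weakly_holomorphic_cusp_forms :: "int \<Rightarrow> nat \<Rightarrow> (complex \<Rightarrow> complex) set" where
  "weakly_holomorphic_cusp_forms k N =
     {f \<in> weakly_holomorphic_forms k N.
        \<forall>A\<in>SL2Z. \<forall>a. q_expansion N (slash k A f) a \<longrightarrow> a 0 = 0}"

text \<open>The coefficients \<open>a\<^sub>f(n)\<close> of the expansion at \<open>\<infinity>\<close>, a cusp of width 1; they are unique.\<close>

definition fourier_coeff :: "(complex \<Rightarrow> complex) \<Rightarrow> int \<Rightarrow> complex" where
  "fourier_coeff f = (SOME a. q_expansion 1 f a)"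


section \<open>The generalised exponential integral\<close>

definition expint_integral :: "complex \<Rightarrow> complex \<Rightarrow> complex" where
  "expint_integral s z = (LBINT t:{1..}. exp (- z * of_real t) * of_real t powr (- s))"

text \<open>\<open>E\<^sub>s\<close> on the plane slit along the non-positive reals. By the identity theorem there is at most
  one such continuation on that set; that there is one is shown below.\<close>

definition is_expint :: "complex \<Rightarrow> (complex \<Rightarrow> complex) \<Rightarrow> bool" where
  "is_expint s g \<longleftrightarrow>
     g holomorphic_on (- \<real>\<^sub>\<le>\<^sub>0) \<and> (\<forall>z. Re z > 0 \<longrightarrow> g z = expint_integral s z)"

definition expint :: "complex \<Rightarrow> complex \<Rightarrow> complex" where
  "expint s = (SOME g. is_expint s g)"

lemma set_integrable_expint:
  assumes "Re z > 0"
  shows "set_integrable lborel {1..} (\<lambda>t. exp (- z * of_real t) * of_real t powr (- s))"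
proof -
  define b where "b = complex_of_real (\<bar>Re s\<bar> + 1)"
  have "(\<lambda>t. complex_of_real t powr (b - 1) / of_real (exp (Re z * t))) absolutely_integrable_on {0<..}"
    by (rule absolutely_integrable_Gamma_integral) (use assms in \<open>auto simp: b_def\<close>)
  hence "(\<lambda>t. complex_of_real t powr (b - 1) / of_real (exp (Re z * t))) absolutely_integrable_on {1..}"
    by (rule set_integrable_subset) auto
  hence int: "set_integrable lborel {1..} (\<lambda>t. complex_of_real t powr (b - 1) / of_real (exp (Re z * t)))"
    unfolding set_integrable_def by (subst (asm) integrable_completion) auto
  show ?thesis
  proof (rule set_integrable_bound[OF int])
    show "set_borel_measurable lborel {1..} (\<lambda>t. exp (- z * of_real t) * complex_of_real t powr (- s))"
      unfolding set_borel_measurable_def by measurable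
    show "AE t in lborel. t \<in> {1..} \<longrightarrow> norm (exp (- z * of_real t) * complex_of_real t powr (- s))
            \<le> norm (complex_of_real t powr (b - 1) / complex_of_real (exp (Re z * t)))"
    proof (intro AE_I2 impI)
      fix t :: real assume t: "t \<in> {1..}"
      have "t powr (- Re s) \<le> t powr \<bar>Re s\<bar>"
        using t by (intro powr_mono) auto
      thus "norm (exp (- z * of_real t) * complex_of_real t powr (- s))
            \<le> norm (complex_of_real t powr (b - 1) / complex_of_real (exp (Re z * t)))"
        using t by (simp add: norm_mult norm_divide norm_powr_real_powr b_def exp_minus field_simps)
    qed
  qed
qed

lemma starlike_slit: "starlike (- \<real>\<^sub>\<le>\<^sub>0 :: complex set)"
proof -
  have "(\<real>\<^sub>\<le>\<^sub>0 :: complex set) = complex_of_real ` {..0}"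
    by (auto elim!: nonpos_Reals_cases)
  thus ?thesis using starlike_slotted_complex_plane_left[of 0] by simp
qed

lemma is_expint_exists: "\<exists>g. is_expint s g"
proof -
  define S where "S = (- \<real>\<^sub>\<le>\<^sub>0 :: complex set)"
  define h where "h = (\<lambda>z. z powr (- s) * exp (- z))"
  have S: "open S" "starlike S"
    using starlike_slit by (auto simp: S_def)
  have h: "h holomorphic_on S"
    unfolding h_def S_def by (intro holomorphic_intros) auto
  obtain P where P: "\<And>z. z \<in> S \<Longrightarrow> (P has_field_derivative h z) (at z)"
    using holomorphic_starlike_primitive[of S h "{}"] h S
    by (auto simp: holomorphic_on_imp_continuous_on holomorphic_on_open field_differentiable_def)
  have right: "z \<in> S" if "Re z > 0" for z
    using that by (auto simp: S_def complex_nonpos_Reals_iff)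
  have seg: "Re x \<ge> min (Re u) (Re v)" if "x \<in> closed_segment u v" for u v x :: complex
  proof -
    have "convex {x. Re x \<ge> min (Re u) (Re v)}" by (rule convex_halfspace_Re_ge)
    hence "closed_segment u v \<subseteq> {x. Re x \<ge> min (Re u) (Re v)}"
      by (rule closed_segment_subset[rotated 2]) auto
    thus ?thesis using that by auto
  qed
  have contour: "(h has_contour_integral (P v - P u)) (linepath u v)" if "Re u > 0" "Re v > 0" for u v
    using contour_integral_primitive[of S P h "linepath u v"] P right seg[of _ u v] that
    by (force intro: has_field_derivative_at_within)
  have finite_part: "z powr (1 - s) * (LBINT t:{1..T}. exp (- z * of_real t) * of_real t powr (- s))
                       = P (of_real T * z) - P z"
    if z: "Re z > 0" and T: "T > 1" for z T
  proof -
    have nz: "z \<noteq> 0" using z by auto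
    have "set_integrable lborel {1..T} (\<lambda>t. exp (- z * of_real t) * of_real t powr (- s))"
      by (rule set_integrable_subset[OF set_integrable_expint[OF z]]) auto
    hence 1: "(LBINT t:{1..T}. exp (- z * of_real t) * of_real t powr (- s)) =
               integral {1..T} (\<lambda>t. exp (- z * of_real t) * of_real t powr (- s))"
      by (rule set_borel_integral_eq_integral)
    have "((\<lambda>t. P (of_real t * z)) has_vector_derivative (z * h (of_real t * z))) (at t within {1..T})"
      if t: "t \<in> {1..T}" for t
    proof -
      have "of_real t * z \<in> S" using t z by (intro right) auto
      from P[OF this] have "((\<lambda>w. P (w * z)) has_field_derivative (h (of_real t * z) * z)) (at (of_real t))"
        by (rule DERIV_chain2) (auto intro!: derivative_eq_intros)
      hence "((\<lambda>t. P (of_real t * z)) has_vector_derivative (h (of_real t * z) * z)) (at t within {1..T})"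
        by (rule has_vector_derivative_real_field)
      thus ?thesis by (simp add: mult.commute)
    qed
    hence "((\<lambda>t. z * h (of_real t * z)) has_integral (P (of_real T * z) - P (of_real 1 * z))) {1..T}"
      using T by (intro fundamental_theorem_of_calculus) auto
    moreover have "z * h (of_real t * z) = z powr (1 - s) * (exp (- z * of_real t) * of_real t powr (- s))"
      if "t \<in> {1..T}" for t
    proof -
      have "(of_real t * z) powr (- s) = of_real t powr (- s) * z powr (- s)"
        using that by (intro powr_times_real_left) auto
      moreover have "z * z powr (- s) = z powr (1 - s)"
        using nz by (simp add: powr_diff powr_minus field_simps)
      ultimately show ?thesis
        by (simp add: h_def mult_ac)
    qed
    ultimately have "((\<lambda>t. z powr (1 - s) * (exp (- z * of_real t) * of_real t powr (- s)))
                        has_integral (P (of_real T * z) - P z)) {1..T}"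
      by (subst (asm) has_integral_cong) auto
    thus ?thesis
      by (subst 1) (simp add: integral_unique flip: integral_mult_right)
  qed
  have lim: "((\<lambda>T. P (of_real T * z) - P z) \<longlongrightarrow> z powr (1 - s) * expint_integral s z) at_top"
    if z: "Re z > 0" for z
  proof -
    have "((\<lambda>T. z powr (1 - s) * (LBINT t:{1..T}. exp (- z * of_real t) * of_real t powr (- s)))
             \<longlongrightarrow> z powr (1 - s) * expint_integral s z) at_top"
      unfolding expint_integral_def
      by (intro tendsto_mult tendsto_const tendsto_set_lebesgue_integral_at_top set_integrable_expint z) auto
    thus ?thesis
      by (rule Lim_transform_eventually)
         (use eventually_gt_at_top[of 1] in eventually_elim, use finite_part z in auto)
  qed
  define L where "L = expint_integral s 1 + P 1"
  have L: "((\<lambda>T. P (of_real T)) \<longlongrightarrow> L) at_top"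
    using tendsto_add[OF lim[of 1] tendsto_const[of "P 1"]] by (simp add: L_def)
  have diff: "((\<lambda>T. P (of_real T * z) - P (of_real T)) \<longlongrightarrow> 0) at_top" if z: "Re z > 0" for z
  proof -
    define m where "m = min (Re z) 1"
    define M where "M = max (norm z) 1"
    have m: "0 < m" "m \<le> Re z" "m \<le> 1" using z by (auto simp: m_def)
    have M: "1 \<le> M" "norm z \<le> M" by (auto simp: M_def)
    define C where "C = exp (pi * \<bar>Im s\<bar>)"
    have bound: "norm (P (of_real T * z) - P (of_real T))
        \<le> (C * ((T * m) powr (- Re s) + (T * M) powr (- Re s)) * exp (- (T * m))) * (T * norm (z - 1))"
      if T: "T > 1" for T
    proof -
      have "norm (P (of_real T * z) - P (of_real T))
          \<le> (C * ((T * m) powr (- Re s) + (T * M) powr (- Re s)) * exp (- (T * m))) * norm (of_real T * z - of_real T)"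
      proof (rule has_contour_integral_bound_linepath[OF contour])
        fix x assume x: "x \<in> closed_segment (complex_of_real T) (of_real T * z)"
        have Rex: "Re x \<ge> T * m"
        proof -
          have "min (Re (complex_of_real T)) (Re (of_real T * z)) \<ge> T * m"
            using T m by simp
          thus ?thesis using seg[OF x] by linarith
        qed
        have pos: "0 < T * m" using T m by simp
        have nx1: "norm x \<ge> T * m" using Rex complex_Re_le_cmod[of x] by linarith
        have nx2: "norm x \<le> T * M"
        proof -
          have "closed_segment (complex_of_real T) (of_real T * z) \<subseteq> cball 0 (T * M)"
            using T M by (intro closed_segment_subset) (auto simp: norm_mult)
          thus ?thesis using x by auto
        qed
        have x0: "x \<noteq> 0" using nx1 pos by auto
        have A: "norm (x powr (- s)) \<le> C * norm x powr (- Re s)"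
        proof -
          have eq: "norm (x powr (- s)) = norm x powr (- Re s) * exp (Im s * Im (Ln x))"
            using x0 by (simp add: powr_def exp_add[symmetric] algebra_simps)
          have "Im s * Im (Ln x) \<le> pi * \<bar>Im s\<bar>"
          proof -
            have "\<bar>Im (Ln x)\<bar> \<le> pi"
              using mpi_less_Im_Ln[OF x0] Im_Ln_le_pi[OF x0] by linarith
            hence "\<bar>Im s\<bar> * \<bar>Im (Ln x)\<bar> \<le> \<bar>Im s\<bar> * pi" by (intro mult_left_mono) auto
            thus ?thesis by (metis abs_ge_self abs_mult mult.commute order_trans)
          qed
          hence "norm x powr (- Re s) * exp (Im s * Im (Ln x)) \<le> norm x powr (- Re s) * C"
            unfolding C_def by (intro mult_left_mono) auto
          thus ?thesis by (simp add: eq mult.commute)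
        qed
        have B: "norm x powr (- Re s) \<le> (T * m) powr (- Re s) + (T * M) powr (- Re s)"
        proof (cases "Re s \<ge> 0")
          case True
          hence "norm x powr (- Re s) \<le> (T * m) powr (- Re s)"
            using nx1 pos by (intro powr_mono2') auto
          thus ?thesis by (simp add: add_increasing2)
        next
          case False
          hence "norm x powr (- Re s) \<le> (T * M) powr (- Re s)"
            using nx2 by (intro powr_mono2) auto
          thus ?thesis by (simp add: add_increasing)
        qed
        have "norm (h x) = norm (x powr (- s)) * exp (- Re x)"
          by (simp add: h_def norm_mult)
        also have "\<dots> \<le> (C * ((T * m) powr (- Re s) + (T * M) powr (- Re s))) * exp (- (T * m))"
        proof (rule mult_mono)
          show "norm (x powr (- s)) \<le> C * ((T * m) powr (- Re s) + (T * M) powr (- Re s))"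
            by (rule order_trans[OF A mult_left_mono[OF B]]) (simp add: C_def)
        qed (use Rex in \<open>auto simp: C_def\<close>)
        finally show "norm (h x) \<le> C * ((T * m) powr (- Re s) + (T * M) powr (- Re s)) * exp (- (T * m))" .
      qed (use T z in \<open>auto simp: C_def\<close>)
      also have "of_real T * z - of_real T = of_real T * (z - 1)"
        by (simp add: algebra_simps)
      finally show ?thesis using T by (simp add: norm_mult)
    qed
    have pw: "((\<lambda>T::real. T powr (1 - Re s) * exp (- (T * m))) \<longlongrightarrow> 0) at_top"
      using m(1) by real_asymp
    have "((\<lambda>T. (C * (m powr (- Re s) + M powr (- Re s)) * norm (z - 1)) * (T powr (1 - Re s) * exp (- (T * m))))
             \<longlongrightarrow> (C * (m powr (- Re s) + M powr (- Re s)) * norm (z - 1)) * 0) at_top"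
      by (intro tendsto_mult tendsto_const pw)
    hence "((\<lambda>T. (C * (m powr (- Re s) + M powr (- Re s)) * norm (z - 1)) * (T powr (1 - Re s) * exp (- (T * m))))
             \<longlongrightarrow> 0) at_top"
      by (simp only: mult_zero_right)
    hence "((\<lambda>T. (C * ((T * m) powr (- Re s) + (T * M) powr (- Re s)) * exp (- (T * m))) * (T * norm (z - 1)))
             \<longlongrightarrow> 0) at_top"
    proof (rule Lim_transform_eventually)
      show "\<forall>\<^sub>F T in at_top.
        C * (m powr - Re s + M powr - Re s) * cmod (z - 1) * (T powr (1 - Re s) * exp (- (T * m))) =
        C * ((T * m) powr - Re s + (T * M) powr - Re s) * exp (- (T * m)) * (T * cmod (z - 1))"
        using eventually_gt_at_top[of 1]
      proof eventually_elim
        case (elim T)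
        thus ?case using m M
          by (simp add: powr_mult powr_diff powr_minus field_simps)
      qed
    qed
    thus ?thesis
      by (rule Lim_null_comparison[rotated])
         (use eventually_gt_at_top[of 1] in eventually_elim, use bound in auto)
  qed
  define g where "g = (\<lambda>z. z powr (s - 1) * (L - P z))"
  have "g holomorphic_on - \<real>\<^sub>\<le>\<^sub>0"
  proof -
    have "P holomorphic_on - \<real>\<^sub>\<le>\<^sub>0"
      using P S by (subst holomorphic_on_open) (auto simp: S_def)
    thus ?thesis unfolding g_def by (intro holomorphic_intros) auto
  qed
  moreover have "g z = expint_integral s z" if z: "Re z > 0" for z
  proof -
    have "((\<lambda>T. (P (of_real T * z) - P (of_real T)) + P (of_real T) - P z) \<longlongrightarrow> 0 + L - P z) at_top"
      by (intro tendsto_add tendsto_diff diff z L tendsto_const)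
    hence "((\<lambda>T. P (of_real T * z) - P z) \<longlongrightarrow> L - P z) at_top" by simp
    with lim[OF z] have "z powr (1 - s) * expint_integral s z = L - P z"
      by (rule tendsto_unique[rotated]) simp
    moreover have "z powr (s - 1) * z powr (1 - s) = 1"
      using z by (subst powr_add[symmetric]) auto
    ultimately show ?thesis
      unfolding g_def by (metis mult.assoc mult_1)
  qed
  ultimately show ?thesis by (auto simp: is_expint_def)
qed

lemma is_expint_expint: "is_expint s (expint s)"
  unfolding expint_def using is_expint_exists by (rule someI_ex)


section \<open>L-series of test functions\<close>

definition laplace :: "(real \<Rightarrow> complex) \<Rightarrow> complex \<Rightarrow> complex" where
  "laplace \<phi> u = (LBINT t:{0<..}. exp (- u * of_real t) * \<phi> t)"

definition phi :: "complex \<Rightarrow> complex \<Rightarrow> real \<Rightarrow> complex" where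
  "phi s w t = indicator {1..} t * exp (- w * of_real t) * of_real t powr (s - 1)"

definition L_series :: "(complex \<Rightarrow> complex) \<Rightarrow> (real \<Rightarrow> complex) \<Rightarrow> complex" where
  "L_series f \<phi> = (\<Sum>\<^sub>\<infinity>n\<in>{n. n \<noteq> 0}. fourier_coeff f n * laplace \<phi> (2 * of_real pi * of_int n))"

text \<open>\<open>L_phi_term f s w n\<close> is the \<open>n\<close>-th term of \<open>L_series f (phi s w)\<close>, continued analytically in
  \<open>w\<close>, and \<open>L_phi f s w\<close> is the value at \<open>phi s w\<close> of the L-series so continued. Almost all
  coefficients of negative index vanish, so it does not matter that \<open>n\<close> is not bounded below.\<close>

definition L_phi_term :: "(complex \<Rightarrow> complex) \<Rightarrow> complex \<Rightarrow> complex \<Rightarrow> int \<Rightarrow> complex" where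
  "L_phi_term f s w n = fourier_coeff f n * expint (1 - s) (2 * of_real pi * of_int n + w)"

definition L_phi :: "(complex \<Rightarrow> complex) \<Rightarrow> complex \<Rightarrow> complex \<Rightarrow> complex" where
  "L_phi f s w = (\<Sum>\<^sub>\<infinity>n\<in>{n. n \<noteq> 0}. L_phi_term f s w n)"

lemma laplace_phi: "laplace (phi s w) u = expint_integral (1 - s) (u + w)"
  unfolding laplace_def phi_def expint_integral_def set_lebesgue_integral_def
  by (intro Bochner_Integration.integral_cong)
     (auto simp: indicator_def exp_add[symmetric] algebra_simps)

lemma L_series_phi:
  assumes "\<And>n. n \<noteq> 0 \<Longrightarrow> fourier_coeff f n \<noteq> 0 \<Longrightarrow> Re (2 * of_real pi * of_int n + w) > 0"
  shows "L_series f (phi s w) = L_phi f s w"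
  unfolding L_series_def L_phi_def
proof (rule infsum_cong)
  fix n :: int assume "n \<in> {n. n \<noteq> 0}"
  thus "fourier_coeff f n * laplace (phi s w) (2 * of_real pi * of_int n) = L_phi_term f s w n"
    using assms[of n] is_expint_expint[of "1 - s"]
    by (cases "fourier_coeff f n = 0") (auto simp: L_phi_term_def laplace_phi is_expint_def)
qed


section \<open>The Lerch zeta function\<close>

definition lerch_zeta :: "complex \<Rightarrow> complex \<Rightarrow> complex \<Rightarrow> complex" where
  "lerch_zeta s a z =
     (\<Sum>m. exp (2 * of_real pi * \<i> * of_nat m * a) * (z + of_nat m) powr (- s))"

end

theory Submission
  imports Defs
begin

text \<open>
  Put \<open>a = 1 - s\<close> and expand the Lerch zeta function. As \<open>f\<close> has period 1, its \<open>m\<close>-th term times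
  \<open>f z * exp (\<i> * w * z)\<close> is the value at \<open>z + m\<close> of \<open>f z * exp (\<i> * w * z) * z powr (- a)\<close>, so the
  segments from \<open>\<i> + m\<close> to \<open>\<i> + m + 1\<close> fit together and the right-hand side is an integral over the
  horizontal ray from \<open>\<i>\<close> to \<open>\<i> + \<infinity>\<close>. In the Fourier expansion of \<open>f\<close> the \<open>n\<close>-th term
  contributes \<open>exp (\<i> * u * z) * z powr (- a)\<close> with \<open>u = 2 * pi * n + w\<close>, and \<open>z = \<i> * t\<close> turns its
  integral over the ray into \<open>\<i> powr (1 - a)\<close> times the integral of \<open>exp (- u * t) * t powr (- a)\<close>
  over the vertical ray from \<open>1\<close> to \<open>1 - \<i> * \<infinity>\<close>, which is the continuation of \<open>E\<^sub>a\<close> at \<open>u\<close>. Since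
  \<open>\<i> powr s * \<i> powr (- s) = 1\<close>, the L-series results.

  The proof treats one exponential at a time (\<open>has_contour_integral_exp_lerch_zeta\<close>). This
  suffices because the Lerch zeta function is unchanged when an integer is added to its parameter
  \<open>w / (2 * pi)\<close>, so that the same function accompanies every Fourier term. Rotation of the ray
  and analytic continuation are both absorbed into one primitive: \<open>v powr (1 - a) * E\<^sub>a(v)\<close> is the
  incomplete gamma function, which has derivative \<open>- v powr (- a) * exp (- v)\<close> on the whole slit
  plane (\<open>has_field_derivative_upper_gamma\<close>) and vanishes at infinity along the ray
  (\<open>upper_gamma_tendsto_0\<close>). The integrals over the segments therefore telescope. Both the sum over
  \<open>m\<close> and the sum over \<open>n\<close> converge uniformly on the segment from \<open>\<i>\<close> to \<open>\<i> + 1\<close>, so they may be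
  interchanged with the integral. The term \<open>n = 0\<close> is absent because \<open>f\<close> is a cusp form
  (\<open>fourier_coeff_cusp_form\<close>).
\<close>

section \<open>The incomplete gamma function\<close>

text \<open>In the usual notation this is \<open>\<Gamma>(1 - a, v)\<close>, the integral of \<open>x powr (- a) * exp (- x)\<close> from
  \<open>v\<close> to infinity; it is expressed through \<open>expint\<close> so as to be defined on the slit plane.\<close>

definition upper_gamma :: "complex \<Rightarrow> complex \<Rightarrow> complex" where
  "upper_gamma a v = v powr (1 - a) * expint a v"

lemma expint_eq_integral: "Re v > 0 \<Longrightarrow> expint a v = expint_integral a v"
  and holomorphic_on_expint: "expint a holomorphic_on - \<real>\<^sub>\<le>\<^sub>0"
  using is_expint_expint[of a] by (auto simp: is_expint_def)

text \<open>The substitution \<open>x = r * t\<close> in the integral of \<open>E\<^sub>a(r)\<close>, carried out on a primitive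
  \<open>P\<close>. The limit determines \<open>upper_gamma\<close> on the positive axis up to the constant \<open>P(\<infinity>)\<close>.\<close>

lemma upper_gamma_positive_real:
  assumes P: "\<And>v. v \<in> - \<real>\<^sub>\<le>\<^sub>0 \<Longrightarrow> (P has_field_derivative v powr (- a) * exp (- v)) (at v)"
    and r: "r > 0"
  shows "((\<lambda>T. P (of_real (r * T)) - P (of_real r)) \<longlongrightarrow> upper_gamma a (of_real r)) at_top"
proof -
  let ?f = "\<lambda>t. exp (- of_real r * of_real t) * complex_of_real t powr (- a)"
  let ?c = "complex_of_real r powr (1 - a)"
  have int: "set_integrable lborel {1..} ?f"
    using set_integrable_expint[of "of_real r" a] r by simp
  have finite_part: "?c * (LBINT t:{1..T}. ?f t) = P (of_real (r * T)) - P (of_real r)" if T: "T > 1" for T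
  proof -
    have "((\<lambda>t. ?c * ?f t) has_integral (P (of_real (r * T)) - P (of_real (r * 1)))) {1..T}"
    proof (rule fundamental_theorem_of_calculus)
      fix t assume t: "t \<in> {1..T}"
      hence pos: "r * t > 0" using r by simp
      have "((\<lambda>w. P (of_real r * w)) has_field_derivative
              (of_real (r * t) powr (- a) * exp (- of_real (r * t))) * of_real r) (at (of_real t))"
        by (rule DERIV_chain2[where f = P], rule P[THEN DERIV_cong])
           (use pos in \<open>auto intro!: derivative_eq_intros simp flip: of_real_mult\<close>)
      hence "((\<lambda>t. P (of_real (r * t))) has_vector_derivative
              (of_real (r * t) powr (- a) * exp (- of_real (r * t))) * of_real r) (at t within {1..T})"
        using has_vector_derivative_real_field by fastforce
      moreover have "(of_real (r * t) powr (- a) * exp (- of_real (r * t))) * of_real r = ?c * ?f t"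
        using r t by (simp add: powr_times_real powr_diff powr_minus field_simps)
      ultimately show "((\<lambda>t. P (of_real (r * t))) has_vector_derivative ?c * ?f t) (at t within {1..T})"
        by (simp only:)
    qed (use T in auto)
    moreover have "(LBINT t:{1..T}. ?f t) = integral {1..T} ?f"
      by (rule set_borel_integral_eq_integral, rule set_integrable_subset[OF int]) auto
    ultimately show ?thesis
      by (simp add: integral_unique flip: integral_mult_right)
  qed
  have "((\<lambda>T. ?c * (LBINT t:{1..T}. ?f t)) \<longlongrightarrow> ?c * (LBINT t:{1..}. ?f t)) at_top"
    by (intro tendsto_mult tendsto_const tendsto_set_lebesgue_integral_at_top int) auto
  hence "((\<lambda>T. P (of_real (r * T)) - P (of_real r)) \<longlongrightarrow> ?c * (LBINT t:{1..}. ?f t)) at_top"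
    by (rule Lim_transform_eventually)
       (use eventually_gt_at_top[of 1] in eventually_elim, use finite_part in auto)
  moreover have "expint a (of_real r) = (LBINT t:{1..}. ?f t)"
    using r by (simp add: expint_eq_integral expint_integral_def)
  ultimately show ?thesis by (simp add: upper_gamma_def)
qed

text \<open>If \<open>P\<close> is a primitive of \<open>v powr (- a) * exp (- v)\<close> on the slit plane, then
  \<open>upper_gamma a + P\<close> is constant on the positive real axis, with value \<open>P(\<infinity>)\<close>. By the identity
  theorem it is constant on the slit plane.\<close>

lemma has_field_derivative_upper_gamma:
  assumes "v \<notin> \<real>\<^sub>\<le>\<^sub>0"
  shows "(upper_gamma a has_field_derivative - (v powr (- a) * exp (- v))) (at v)"
proof -
  define S where "S = (- \<real>\<^sub>\<le>\<^sub>0 :: complex set)"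
  let ?h = "\<lambda>v. v powr (- a) * exp (- v)"
  have S: "open S" "starlike S"
    using starlike_slit by (auto simp: S_def)
  have h: "?h holomorphic_on S"
    unfolding S_def by (intro holomorphic_intros) auto
  obtain P where P: "\<And>v. v \<in> S \<Longrightarrow> (P has_field_derivative ?h v) (at v)"
    using holomorphic_starlike_primitive[of S ?h "{}"] h S
    by (auto simp: holomorphic_on_imp_continuous_on holomorphic_on_open field_differentiable_def)
  have const: "upper_gamma a (of_real r) + P (of_real r) = upper_gamma a 1 + P 1" if r: "r > 0" for r
  proof -
    have "((\<lambda>T. P (of_real (1 * T)) - P (of_real 1) + P 1) \<longlongrightarrow> upper_gamma a (of_real 1) + P 1) at_top"
      by (intro tendsto_add upper_gamma_positive_real[OF P] tendsto_const) (auto simp: S_def)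
    hence "((\<lambda>T. P (of_real T)) \<longlongrightarrow> upper_gamma a 1 + P 1) at_top" by simp
    moreover have "filterlim (\<lambda>T. r * T) at_top at_top" using r by real_asymp
    ultimately have "((\<lambda>T. P (of_real (r * T))) \<longlongrightarrow> upper_gamma a 1 + P 1) at_top"
      by (rule filterlim_compose)
    moreover have "((\<lambda>T. P (of_real (r * T)) - P (of_real r) + P (of_real r))
                      \<longlongrightarrow> upper_gamma a (of_real r) + P (of_real r)) at_top"
      by (intro tendsto_add upper_gamma_positive_real[OF P] tendsto_const) (auto simp: S_def r)
    ultimately show ?thesis
      by (intro tendsto_unique[where F = at_top]) auto
  qed
  have "upper_gamma a z + P z - (upper_gamma a 1 + P 1) = 0" if "z \<in> S" for z
  proof (rule analytic_continuation[where f = "\<lambda>z. upper_gamma a z + P z - (upper_gamma a 1 + P 1)"])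
    have "P holomorphic_on S"
      using P S by (subst holomorphic_on_open) auto
    thus "(\<lambda>z. upper_gamma a z + P z - (upper_gamma a 1 + P 1)) holomorphic_on S"
      unfolding upper_gamma_def S_def by (intro holomorphic_intros holomorphic_on_expint) auto
    show "connected S" using S by (simp add: starlike_imp_connected)
    show "complex_of_real ` {0<..} \<subseteq> S" "(1::complex) \<in> S" by (auto simp: S_def)
    show "(1::complex) islimpt complex_of_real ` {0<..}"
    proof -
      have "(1::real) islimpt {0<..}"
        by (simp add: interior_limit_point interior_open)
      thus ?thesis
        unfolding islimpt_sequential
      proof safe
        fix f :: "nat \<Rightarrow> real" assume f: "\<forall>n. f n \<in> {0<..} - {1}" "f \<longlonglongrightarrow> 1"
        show "\<exists>g. (\<forall>n. g n \<in> complex_of_real ` {0<..} - {1}) \<and> g \<longlonglongrightarrow> 1"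
          using f tendsto_of_real[OF f(2), where 'a = complex]
          by (intro exI[of _ "\<lambda>n. complex_of_real (f n)"]) auto
      qed
    qed
  qed (use S that const in auto)
  hence eq: "upper_gamma a 1 + P 1 - P z = upper_gamma a z" if "z \<in> S" for z
    using that by (simp add: algebra_simps)
  have "((\<lambda>z. upper_gamma a 1 + P 1 - P z) has_field_derivative - ?h v) (at v)"
    using assms by (auto intro!: derivative_eq_intros P simp: S_def)
  thus ?thesis
    by (rule has_field_derivative_transform_within_open[where S = S]) (use S assms eq in \<open>auto simp: S_def\<close>)
qed

lemma norm_powr_le:
  fixes v b :: complex
  assumes "norm v \<ge> 1"
  shows "norm (v powr b) \<le> exp (pi * \<bar>Im b\<bar>) * norm v powr \<bar>Re b\<bar>"
proof -
  have nz: "v \<noteq> 0" using assms by auto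
  have "\<bar>Im (Ln v)\<bar> \<le> pi"
    using mpi_less_Im_Ln[OF nz] Im_Ln_le_pi[OF nz] by linarith
  hence "\<bar>Im b\<bar> * \<bar>Im (Ln v)\<bar> \<le> \<bar>Im b\<bar> * pi" by (intro mult_left_mono) auto
  hence "- (Im b * Im (Ln v)) \<le> pi * \<bar>Im b\<bar>"
    by (metis abs_ge_minus_self abs_mult mult.commute order_trans)
  moreover have "Re b * ln (norm v) \<le> \<bar>Re b\<bar> * ln (norm v)"
    using assms by (intro mult_right_mono) auto
  moreover have "norm (v powr b) = exp (Re b * ln (norm v) - Im b * Im (Ln v))"
    using nz by (simp add: powr_def)
  moreover have "exp (pi * \<bar>Im b\<bar>) * norm v powr \<bar>Re b\<bar> = exp (pi * \<bar>Im b\<bar> + \<bar>Re b\<bar> * ln (norm v))"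
    using nz by (simp add: powr_def exp_add)
  ultimately show ?thesis by simp
qed

text \<open>For \<open>t \<ge> 1\<close> and \<open>Re v \<ge> 1\<close> the integrand at \<open>v\<close> is at most \<open>exp (1 - Re v)\<close> times the one at
  \<open>1\<close>.\<close>

lemma expint_decay:
  obtains K where "\<And>v. Re v \<ge> 1 \<Longrightarrow> norm (expint a v) \<le> K * exp (- Re v)"
proof
  fix v :: complex assume v: "Re v \<ge> 1"
  let ?f = "\<lambda>v t. exp (- v * of_real t) * complex_of_real t powr (- a)"
  have int: "set_integrable lborel {1..} (?f u)" if "Re u > 0" for u
    using set_integrable_expint[OF that] by simp
  have "norm (expint a v) = norm (LBINT t:{1..}. ?f v t)"
    using v by (simp add: expint_eq_integral expint_integral_def)
  also have "\<dots> \<le> (LBINT t:{1..}. norm (?f v t))"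
    by (rule set_integral_norm_bound, rule int) (use v in auto)
  also have "\<dots> \<le> (LBINT t:{1..}. exp (1 - Re v) * norm (?f 1 t))"
  proof (rule set_integral_mono)
    fix t :: real assume t: "t \<in> {1..}"
    have "(Re v - 1) * 1 \<le> (Re v - 1) * t"
      using t v by (intro mult_left_mono) auto
    hence "exp (- Re v * t) \<le> exp (1 - Re v) * exp (- t)"
      by (simp add: algebra_simps flip: exp_add)
    thus "norm (?f v t) \<le> exp (1 - Re v) * norm (?f 1 t)"
      by (simp add: norm_mult mult_right_mono flip: mult.assoc)
  qed (use int[of v] int[of 1] v in \<open>auto intro: set_integrable_norm\<close>)
  also have "\<dots> = exp 1 * (LBINT t:{1..}. norm (?f 1 t)) * exp (- Re v)"
    by (simp add: exp_diff exp_minus field_simps)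
  finally show "norm (expint a v) \<le> exp 1 * (LBINT t:{1..}. norm (?f 1 t)) * exp (- Re v)" .
qed

text \<open>The exponential decay of \<open>E\<^sub>a\<close> in the right half-plane beats the power of \<open>v\<close>. Wherever
  \<open>u\<close> lies, the points \<open>u + m * c\<close> are eventually in the region where this decay holds.\<close>

lemma upper_gamma_tendsto_0:
  assumes c: "Re c > 0"
  shows "(\<lambda>m. upper_gamma a (u + of_nat m * c)) \<longlonglongrightarrow> 0"
proof -
  obtain K where K: "\<And>v. Re v \<ge> 1 \<Longrightarrow> norm (expint a v) \<le> K * exp (- Re v)"
    using expint_decay by blast
  define B where "B = exp (pi * \<bar>Im (1 - a)\<bar>)"
  define p where "p = \<bar>Re (1 - a)\<bar>"
  have bound: "norm (upper_gamma a (u + of_nat m * c))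
                 \<le> B * (norm u + m * norm c) powr p * (K * exp (- (Re u + m * Re c)))"
    if m: "Re u + real m * Re c \<ge> 1" for m
  proof -
    let ?v = "u + of_nat m * c"
    have Re: "Re ?v = Re u + m * Re c" by simp
    have v: "1 \<le> norm ?v" using m complex_Re_le_cmod[of ?v] Re by linarith
    have "norm ?v \<le> norm u + m * norm c"
      by (metis norm_mult norm_of_nat norm_triangle_ineq)
    hence "norm ?v powr p \<le> (norm u + m * norm c) powr p"
      by (intro powr_mono2) (auto simp: p_def)
    hence "norm (?v powr (1 - a)) \<le> B * (norm u + m * norm c) powr p"
      using norm_powr_le[OF v, of "1 - a"] unfolding B_def p_def
      by (meson exp_ge_zero mult_left_mono order_trans)
    moreover have "norm (expint a ?v) \<le> K * exp (- (Re u + m * Re c))"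
      using K[of ?v] m by simp
    ultimately show ?thesis
      unfolding upper_gamma_def norm_mult by (intro mult_mono) (auto simp: B_def)
  qed
  have "norm c > 0" using c by auto
  hence lim: "(\<lambda>m. B * (norm u + real m * norm c) powr p * (K * exp (- (Re u + real m * Re c)))) \<longlonglongrightarrow> 0"
    using c by real_asymp
  have "eventually (\<lambda>m. Re u + real m * Re c \<ge> 1) sequentially"
    using c by real_asymp
  thus ?thesis
    by (rule Lim_null_comparison[OF eventually_mono[OF _ bound] lim])
qed

section \<open>The Lerch zeta function\<close>

text \<open>The factor \<open>exp (- 2 * pi * m * Im a)\<close> decays geometrically, while \<open>(z + m) powr (- s)\<close> grows at
  most polynomially; the condition on \<open>A\<close> keeps \<open>z + m\<close> outside the unit disc, where
  \<open>norm_powr_le\<close> applies.\<close>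

lemma uniform_limit_lerch_zeta:
  assumes a: "Im a > 0" and A: "bounded A" "\<And>z. z \<in> A \<Longrightarrow> Re z \<ge> 0 \<and> Im z \<ge> 1"
  shows "uniform_limit A
           (\<lambda>M z. \<Sum>m<M. exp (2 * of_real pi * \<i> * of_nat m * a) * (z + of_nat m) powr (- s))
           (lerch_zeta s a) sequentially"
proof -
  obtain R where R: "\<And>z. z \<in> A \<Longrightarrow> norm z \<le> R" and R0: "R > 0"
    using A(1) by (auto simp: bounded_pos)
  define B where "B = exp (pi * \<bar>Im s\<bar>)"
  define p where "p = \<bar>Re s\<bar>"
  define b where "b = 2 * pi * Im a"
  \<comment> \<open>half of the exponential rate is given away to absorb the polynomial factor\<close>
  have "summable (\<lambda>m. exp (- (b * m)) * (B * (R + real m) powr p))"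
  proof (rule summable_comparison_test_bigo)
    have "b > 0" using a by (simp add: b_def)
    thus "(\<lambda>m. exp (- (b * m)) * (B * (R + real m) powr p)) \<in> O(\<lambda>m. exp (- b / 2) ^ m)"
      using R0 unfolding exp_of_nat_mult [symmetric] by real_asymp
    show "summable (\<lambda>m. norm (exp (- b / 2) ^ m))"
      using \<open>b > 0\<close> by (simp add: summable_geometric)
  qed
  moreover have "norm (exp (2 * of_real pi * \<i> * of_nat m * a) * (z + of_nat m) powr (- s))
                   \<le> exp (- (b * m)) * (B * (R + real m) powr p)" if "z \<in> A" for z m
  proof -
    have "1 \<le> norm (z + of_nat m)"
      using A(2)[OF that] abs_Im_le_cmod[of "z + of_nat m"] by simp
    from norm_powr_le[OF this, of "- s"]
    have "norm ((z + of_nat m) powr (- s)) \<le> B * norm (z + of_nat m) powr p"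
      by (simp add: B_def p_def)
    also have "norm (z + of_nat m) \<le> R + m"
      using R[OF that] by (metis add_mono_thms_linordered_semiring(3) norm_of_nat norm_triangle_le)
    hence "B * norm (z + of_nat m) powr p \<le> B * (R + m) powr p"
      by (intro mult_left_mono powr_mono2) (auto simp: B_def p_def)
    finally have "norm ((z + of_nat m) powr (- s)) \<le> B * (R + m) powr p" .
    moreover have "norm (exp (2 * of_real pi * \<i> * of_nat m * a)) = exp (- (b * m))"
      by (simp add: b_def mult_ac)
    ultimately show ?thesis
      by (simp only: norm_mult mult_left_mono exp_ge_zero)
  qed
  ultimately show ?thesis
    unfolding lerch_zeta_def by (intro Weierstrass_m_test)
qed

lemma lerch_zeta_plus_of_int: "lerch_zeta s (a + of_int n) z = lerch_zeta s a z"
proof -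
  have "exp (2 * of_real pi * \<i> * of_nat m * (a + of_int n)) = exp (2 * of_real pi * \<i> * of_nat m * a)" for m
    using exp_plus_2pin[of "2 * of_real pi * \<i> * of_nat m * a" "int m * n"]
    by (simp add: algebra_simps)
  thus ?thesis by (simp add: lerch_zeta_def)
qed

lemma continuous_on_lerch_zeta:
  assumes a: "Im a > 0" and A: "bounded A" "\<And>z. z \<in> A \<Longrightarrow> Re z \<ge> 0 \<and> Im z \<ge> 1"
  shows "continuous_on A (lerch_zeta s a)"
proof (rule uniform_limit_theorem[OF _ uniform_limit_lerch_zeta[OF assms]])
  have "continuous_on A (\<lambda>z. (z + of_nat m) powr (- s))" for m
    by (rule continuous_on_powr_complex)
       (use A(2) in \<open>force intro!: continuous_intros simp: complex_eq_iff\<close>)+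
  thus "\<forall>\<^sub>F M in sequentially. continuous_on A
    (\<lambda>z. \<Sum>m<M. exp (2 * of_real pi * \<i> * of_nat m * a) * (z + of_nat m) powr (- s))"
    by (intro always_eventually allI continuous_on_sum continuous_on_mult continuous_on_const)
qed auto

section \<open>The integral of one exponential against the Lerch zeta function\<close>

text \<open>The chain rule, once \<open>(- \<i> * u * z) powr (- a)\<close> is known to split into the powers of \<open>- \<i>\<close>,
  \<open>u\<close> and \<open>z\<close>. This is a matter of branches: for \<open>u\<close> in the upper half-plane and \<open>z\<close> in the
  first quadrant the arguments of the factors add up to a number in the interval from \<open>- pi / 2\<close> to
  \<open>pi\<close>, so no logarithm jumps and the product avoids the slit.\<close>

lemma has_field_derivative_ray_primitive:
  assumes u: "Im u > 0" and z: "Re z \<ge> 0" "Im z > 0"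
  shows "((\<lambda>z. - (\<i> powr (1 - a) * u powr (a - 1) * upper_gamma a (- \<i> * u * z)))
           has_field_derivative exp (\<i> * u * z) * z powr (- a)) (at z)"
proof -
  have u0: "u \<noteq> 0" and z0: "z \<noteq> 0" using u z by auto
  have argu: "0 < Im (Ln u)" "Im (Ln u) < pi"
    using u Im_Ln_pos_lt_imp by (auto simp: Im_Ln_pos_lt)
  have argz: "0 < Im (Ln z)" "Im (Ln z) \<le> pi / 2"
    using z Re_Ln_pos_le[OF z0] Im_Ln_pos_lt_imp by auto
  have Lni: "Ln (u * (- \<i> * z)) = Ln u + (Ln z - \<i> * (pi / 2))"
  proof -
    have 1: "Ln (- \<i> * z) = Ln z - \<i> * (pi / 2)"
      using argz z0 by (subst Ln_times) auto
    have "Im (Ln u + Ln (- \<i> * z)) > - pi" "Im (Ln u + Ln (- \<i> * z)) \<le> pi"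
      unfolding 1 using argu argz by auto
    thus ?thesis unfolding 1[symmetric]
      using z0 u0 by (subst Ln_times) auto
  qed
  have assoc: "- \<i> * u * z = u * (- \<i> * z)" by simp
  have slit: "- \<i> * u * z \<notin> \<real>\<^sub>\<le>\<^sub>0"
  proof
    assume "- \<i> * u * z \<in> \<real>\<^sub>\<le>\<^sub>0"
    then obtain r where r: "- \<i> * u * z = of_real r" "r \<le> 0" by (rule nonpos_Reals_cases)
    hence "r < 0" using u0 z0 by (cases "r = 0") auto
    hence "Im (Ln (- \<i> * u * z)) = pi" using r(1) by (simp add: Ln_of_real')
    hence "Im (Ln u) + Im (Ln z) - pi / 2 = pi"
      unfolding assoc Lni by simp
    thus False using argu argz by simp
  qed
  have "((\<lambda>z. - (\<i> powr (1 - a) * u powr (a - 1) * upper_gamma a (- \<i> * u * z)))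
           has_field_derivative
         - (\<i> powr (1 - a) * u powr (a - 1) *
             (- ((- \<i> * u * z) powr (- a) * exp (- (- \<i> * u * z))) * (- \<i> * u)))) (at z)"
    by (rule DERIV_minus, rule DERIV_cmult, rule DERIV_chain2[where f = "upper_gamma a"], rule has_field_derivative_upper_gamma[OF slit])
       (auto intro!: derivative_eq_intros)
  moreover have "- (\<i> powr (1 - a) * u powr (a - 1) *
             (- ((- \<i> * u * z) powr (- a) * exp (- (- \<i> * u * z))) * (- \<i> * u)))
        = exp (\<i> * u * z) * z powr (- a)"
  proof -
    have pow: "(- \<i> * u * z) powr (- a) = u powr (- a) * z powr (- a) * \<i> powr a"
      unfolding assoc powr_def Lni using u0 z0 by (simp add: algebra_simps flip: exp_add)
    have "u powr (a - 1) * (u powr (- a) * u) = 1"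
      using u0 by (simp add: powr_diff powr_minus)
    moreover have "\<i> powr (1 - a) * \<i> powr a * \<i> = -1"
      by (simp add: powr_diff)
    moreover have "- (\<i> powr (1 - a) * u powr (a - 1) *
             (- ((- \<i> * u * z) powr (- a) * exp (- (- \<i> * u * z))) * (- \<i> * u)))
        = - (\<i> powr (1 - a) * \<i> powr a * \<i>) * (u powr (a - 1) * (u powr (- a) * u)) *
             (exp (\<i> * u * z) * z powr (- a))"
      unfolding pow by (simp add: algebra_simps)
    ultimately show ?thesis by simp
  qed
  ultimately show ?thesis by simp
qed

text \<open>The case of the theorem in which \<open>f\<close> is a single exponential, absorbed into \<open>u\<close>. The
  \<open>m\<close>-th summand has the primitive \<open>\<Phi> (z + m)\<close>, so the partial sums of the integrals telescope to
  \<open>\<Phi> (\<i> + M) - \<Phi> \<i>\<close>; the first term tends to 0 since \<open>- \<i> * u * (\<i> + M) = u - \<i> * u * M\<close> moves to the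
  right, and \<open>- \<Phi> \<i>\<close> is the claimed value.\<close>

lemma has_contour_integral_exp_lerch_zeta:
  assumes u: "Im u > 0"
  shows "((\<lambda>z. exp (\<i> * u * z) * lerch_zeta a (u / (2 * of_real pi)) z)
           has_contour_integral \<i> powr (1 - a) * expint a u) (linepath \<i> (\<i> + 1))"
proof -
  define \<Phi> where "\<Phi> z = - (\<i> powr (1 - a) * u powr (a - 1) * upper_gamma a (- \<i> * u * z))" for z
  define S where "S = closed_segment \<i> (\<i> + 1)"
  have S: "Re z \<ge> 0" "Im z = 1" if "z \<in> S" for z
    using that by (auto simp: S_def in_segment)
  let ?term = "\<lambda>m z. exp (2 * of_real pi * \<i> * of_nat m * (u / (2 * of_real pi))) * (z + of_nat m) powr (- a)"
  have summand: "exp (\<i> * u * z) * ?term m z = exp (\<i> * u * (z + of_nat m)) * (z + of_nat m) powr (- a)" for m z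
    by (simp add: ring_distribs exp_add mult_ac)
  have one: "((\<lambda>z. exp (\<i> * u * z) * ?term m z) has_contour_integral
               \<Phi> (\<i> + of_nat (Suc m)) - \<Phi> (\<i> + of_nat m)) (linepath \<i> (\<i> + 1))" for m
  proof -
    have "((\<lambda>z. \<Phi> (z + of_nat m)) has_field_derivative exp (\<i> * u * z) * ?term m z) (at z within S)"
      if "z \<in> S" for z
    proof -
      have "(\<Phi> has_field_derivative exp (\<i> * u * z) * ?term m z) (at (z + of_nat m))"
        unfolding \<Phi>_def summand using S[OF that] by (intro has_field_derivative_ray_primitive u) auto
      hence "((\<lambda>z. \<Phi> (z + of_nat m)) has_field_derivative exp (\<i> * u * z) * ?term m z) (at z)"
        by (simp add: DERIV_shift)
      thus ?thesis by (rule has_field_derivative_at_within)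
    qed
    from contour_integral_primitive[OF this, of "linepath \<i> (\<i> + 1)"] show ?thesis
      by (simp add: S_def add_ac)
  qed
  have finite_sum: "((\<lambda>z. exp (\<i> * u * z) * (\<Sum>m<M. ?term m z)) has_contour_integral
               \<Phi> (\<i> + of_nat M) - \<Phi> \<i>) (linepath \<i> (\<i> + 1))" for M
    using has_contour_integral_sum[of "{..<M}" "\<lambda>m z. exp (\<i> * u * z) * ?term m z", OF _ one]
      sum_lessThan_telescope[of "\<lambda>m. \<Phi> (\<i> + of_nat m)" M]
    by (simp add: sum_distrib_left)
  have lerch: "bounded S" "Im (u / (2 * of_real pi)) > 0"
    using u by (simp_all add: S_def bounded_closed_segment)
  have cont: "continuous_on S (lerch_zeta a (u / (2 * of_real pi)))"
    using S lerch by (intro continuous_on_lerch_zeta) auto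
  have bdd: "bounded (g ` S)" if "continuous_on S g" for g :: "complex \<Rightarrow> complex"
    by (intro compact_imp_bounded compact_continuous_image that) (simp add: S_def)
  have "uniform_limit S (\<lambda>M z. exp (\<i> * u * z) * (\<Sum>m<M. ?term m z))
          (\<lambda>z. exp (\<i> * u * z) * lerch_zeta a (u / (2 * of_real pi)) z) sequentially"
    by (intro uniform_lim_mult uniform_limit_const uniform_limit_lerch_zeta bdd cont lerch continuous_intros)
       (use S in auto)
  hence lim: "(\<lambda>z. exp (\<i> * u * z) * lerch_zeta a (u / (2 * of_real pi)) z)
                 contour_integrable_on linepath \<i> (\<i> + 1)"
             "(\<lambda>M. \<Phi> (\<i> + of_nat M) - \<Phi> \<i>) \<longlonglongrightarrow>
                contour_integral (linepath \<i> (\<i> + 1)) (\<lambda>z. exp (\<i> * u * z) * lerch_zeta a (u / (2 * of_real pi)) z)"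
    using contour_integral_uniform_limit[where F = sequentially and B = 1 and \<gamma> = "linepath \<i> (\<i> + 1)"
        and f = "\<lambda>M z. exp (\<i> * u * z) * (\<Sum>m<M. ?term m z)"
        and l = "\<lambda>z. exp (\<i> * u * z) * lerch_zeta a (u / (2 * of_real pi)) z"]
      has_contour_integral_integrable[OF finite_sum] contour_integral_unique[OF finite_sum]
    by (simp_all add: S_def)
  have "(\<lambda>M. upper_gamma a (u + of_nat M * (- \<i> * u))) \<longlonglongrightarrow> 0"
    using u by (intro upper_gamma_tendsto_0) auto
  moreover have "- \<i> * u * (\<i> + of_nat M) = u + of_nat M * (- \<i> * u)" for M
    by (simp add: algebra_simps)
  ultimately have "(\<lambda>M. \<Phi> (\<i> + of_nat M)) \<longlonglongrightarrow> - (\<i> powr (1 - a) * u powr (a - 1) * 0)"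
    unfolding \<Phi>_def by (intro tendsto_intros) simp
  hence "(\<lambda>M. \<Phi> (\<i> + of_nat M) - \<Phi> \<i>) \<longlonglongrightarrow> 0 - \<Phi> \<i>"
    by (intro tendsto_intros) simp
  moreover have "- \<Phi> \<i> = \<i> powr (1 - a) * expint a u"
  proof -
    have "- \<i> * u * \<i> = u" by (simp add: mult_ac)
    thus ?thesis using u by (auto simp: \<Phi>_def upper_gamma_def powr_diff)
  qed
  ultimately have "contour_integral (linepath \<i> (\<i> + 1))
      (\<lambda>z. exp (\<i> * u * z) * lerch_zeta a (u / (2 * of_real pi)) z) = \<i> powr (1 - a) * expint a u"
    using lim(2) LIMSEQ_unique by fastforce
  thus ?thesis using lim(1) by (metis has_contour_integral_integral)
qed

section \<open>Fourier expansion at infinity\<close>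

lemma q_expansion_change_width:
  assumes N: "N \<ge> 1"
  shows "q_expansion N g (\<lambda>n. if int N dvd n then b (n div int N) else 0) \<longleftrightarrow> q_expansion 1 g b"
    (is "q_expansion N g ?a \<longleftrightarrow> _")
proof -
  have "(\<exists>n0::nat. \<forall>n < - int n0. ?a n = 0) \<longleftrightarrow> (\<exists>n0::nat. \<forall>n < - int n0. b n = 0)"
  proof safe
    fix n0 assume n0: "\<forall>n < - int n0. ?a n = 0"
    have "b n = 0" if n: "n < - int n0" for n
    proof -
      have "int N * n \<le> 1 * n" using N n by (intro mult_right_mono_neg) auto
      with n0[rule_format, of "int N * n"] n N show ?thesis by auto
    qed
    thus "\<exists>n0::nat. \<forall>n < - int n0. b n = 0" by blast
  next
    fix n0 assume n0: "\<forall>n < - int n0. b n = 0"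
    have "?a n = 0" if n: "n < - int (N * n0)" for n
    proof (cases "int N dvd n")
      case True
      then obtain m where m: "n = int N * m" by (elim dvdE)
      have "int N * m < int N * (- int n0)" using n m by simp
      hence "m < - int n0" using N by (subst (asm) mult_less_cancel_left_pos) auto
      thus ?thesis using n0 m N by simp
    qed simp
    thus "\<exists>n0::nat. \<forall>n < - int n0. ?a n = 0" by blast
  qed
  moreover have "((\<lambda>n. ?a n * exp (2 * of_real pi * \<i> * of_int n * z / of_nat N)) has_sum g z) UNIV \<longleftrightarrow>
                 ((\<lambda>n. b n * exp (2 * of_real pi * \<i> * of_int n * z / of_nat 1)) has_sum g z) UNIV"
    (is "(?F has_sum _) _ \<longleftrightarrow> (?G has_sum _) _") for z
  proof -
    have inj: "inj (\<lambda>m. int N * m)" using N by (auto simp: inj_def)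
    have "(?F has_sum g z) UNIV \<longleftrightarrow> (?F has_sum g z) (range (\<lambda>m. int N * m))"
      by (rule has_sum_cong_neutral) auto
    also have "\<dots> \<longleftrightarrow> (?F \<circ> (\<lambda>m. int N * m) has_sum g z) UNIV"
      by (rule has_sum_reindex[OF inj])
    also have "?F \<circ> (\<lambda>m. int N * m) = ?G"
      using N by (auto simp: fun_eq_iff mult.assoc)
    finally show ?thesis .
  qed
  ultimately show ?thesis by (simp add: q_expansion_def)
qed

lemma sum_roots_of_unity:
  assumes N: "N \<ge> 1"
  shows "(\<Sum>j<N. exp (2 * of_real pi * \<i> * of_int n * of_nat j / of_nat N)) =
           (if int N dvd n then of_nat N else (0::complex))"
proof -
  define \<omega> where "\<omega> = exp (2 * of_real pi * \<i> * of_int n / of_nat N :: complex)"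
  have pow: "exp (2 * of_real pi * \<i> * of_int n * of_nat j / of_nat N) = \<omega> ^ j" for j
    by (simp add: \<omega>_def mult_ac flip: exp_of_nat_mult)
  have "\<omega> ^ N = exp (\<i> * (of_int n * (of_real pi * 2)))"
    unfolding pow[symmetric] using N by (simp add: mult_ac)
  hence \<omega>N: "\<omega> ^ N = 1" by simp
  have "\<omega> = 1 \<longleftrightarrow> (\<exists>m::int. 2 * pi * n / N = of_int (2 * m) * pi)"
    by (simp add: \<omega>_def exp_eq_1)
  also have "\<dots> \<longleftrightarrow> (\<exists>m::int. real_of_int n = real_of_int (int N * m))"
    using N by (simp add: field_simps)
  also have "\<dots> \<longleftrightarrow> int N dvd n"
    unfolding of_int_eq_iff dvd_def ..
  finally show ?thesis
    unfolding pow using \<omega>N by (auto simp: geometric_sum)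
qed

lemma has_sum_finite_sum:
  assumes "finite J" "\<And>j. j \<in> J \<Longrightarrow> (F j has_sum S j) A"
  shows "((\<lambda>n. \<Sum>j\<in>J. F j n :: complex) has_sum (\<Sum>j\<in>J. S j)) A"
  using assms by (induction J rule: finite_induct) (auto intro: has_sum_add)

text \<open>Replacing \<open>g\<close> by the average of its \<open>N\<close> translates \<open>g (z + j)\<close> leaves it unchanged and
  multiplies the \<open>n\<close>-th Fourier term by the mean of the \<open>N\<close>-th roots of unity \<open>exp (2 * pi * \<i> * n * j / N)\<close>,
  which removes all terms with \<open>n\<close> not divisible by \<open>N\<close>.\<close>

lemma q_expansion_of_periodic:
  assumes N: "N \<ge> 1" and g: "q_expansion N g a"
    and per: "\<And>z. z \<in> upper_half_plane \<Longrightarrow> g (z + 1) = g z"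
  shows "q_expansion 1 g (\<lambda>m. a (int N * m))"
proof -
  let ?e = "\<lambda>n z. exp (2 * of_real pi * \<i> * of_int n * z / of_nat N) :: complex"
  have shift: "z + of_nat j \<in> upper_half_plane \<and> g (z + of_nat j) = g z" if "z \<in> upper_half_plane" for z j
    using that
  proof (induction j)
    case (Suc j)
    thus ?case using per[of "z + of_nat j"] by (auto simp: upper_half_plane_def add_ac)
  qed simp
  have "((\<lambda>n. (if int N dvd n then a n else 0) * ?e n z) has_sum g z) UNIV"
    if z: "z \<in> upper_half_plane" for z
  proof -
    have "((\<lambda>n. a n * ?e n (z + of_nat j)) has_sum g z) UNIV" for j
      using g shift[OF z, of j] unfolding q_expansion_def by metis
    hence "((\<lambda>n. 1 / of_nat N * (\<Sum>j<N. a n * ?e n (z + of_nat j))) has_sum 1 / of_nat N * (\<Sum>j<N. g z)) UNIV"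
      by (intro has_sum_cmult_right has_sum_finite_sum) auto
    moreover have "1 / of_nat N * (\<Sum>j<N. a n * ?e n (z + of_nat j)) = (if int N dvd n then a n else 0) * ?e n z" for n
    proof -
      have "?e n (z + of_nat j) = ?e n z * ?e n (of_nat j)" for j
        by (simp add: ring_distribs add_divide_distrib exp_add)
      hence "(\<Sum>j<N. a n * ?e n (z + of_nat j)) = a n * ?e n z * (\<Sum>j<N. ?e n (of_nat j))"
        by (simp add: sum_distrib_left mult_ac)
      thus ?thesis using N by (subst (asm) sum_roots_of_unity) auto
    qed
    ultimately show ?thesis using N by simp
  qed
  moreover have "(if int N dvd n then a (int N * (n div int N)) else 0) = (if int N dvd n then a n else 0)" for n
    by simp
  moreover have "\<exists>n0::nat. \<forall>n < - int n0. (if int N dvd n then a n else 0) = 0"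
    using g unfolding q_expansion_def by auto
  ultimately have "q_expansion N g (\<lambda>n. if int N dvd n then a (int N * (n div int N)) else 0)"
    unfolding q_expansion_def by simp
  thus ?thesis
    using q_expansion_change_width[OF N, of g "\<lambda>m. a (int N * m)"] by simp
qed

text \<open>The translation by 1 lies in \<open>Gamma0 N\<close>, so the expansion of width \<open>N\<close> at infinity comes
  from one of width 1. Conversely, any expansion of width 1 is also one of width \<open>N\<close> with the same
  constant term, and to that one the cusp condition applies.\<close>

lemma fourier_coeff_cusp_form:
  assumes N: "N \<ge> 1" and f: "f \<in> weakly_holomorphic_cusp_forms k N"
  shows "q_expansion 1 f (fourier_coeff f)" and "fourier_coeff f 0 = 0"
proof -
  define T :: "int^2^2" where "T = vector [vector [1, 1], vector [0, 1]]"
  have T: "T \<in> Gamma0 N" by (simp add: T_def Gamma0_def SL2Z_def det_2)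
  have I: "mat 1 \<in> SL2Z" by (simp add: SL2Z_def)
  have slash_I: "slash k (mat 1) f = f"
    by (simp add: slash_def mat_def fun_eq_iff)
  have "f (z + 1) = f z" if "z \<in> upper_half_plane" for z
  proof -
    have "slash k T f z = f z"
      using f T that by (auto simp: weakly_holomorphic_cusp_forms_def weakly_holomorphic_forms_def)
    thus ?thesis by (simp add: slash_def T_def)
  qed
  moreover obtain a where "q_expansion N f a"
    using f I slash_I by (fastforce simp: weakly_holomorphic_cusp_forms_def weakly_holomorphic_forms_def)
  ultimately have "q_expansion 1 f (\<lambda>m. a (int N * m))"
    by (intro q_expansion_of_periodic N) auto
  thus exp1: "q_expansion 1 f (fourier_coeff f)"
    unfolding fourier_coeff_def by (rule someI[where P = "q_expansion 1 f"])
  have "q_expansion N (slash k (mat 1) f)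
          (\<lambda>n. if int N dvd n then fourier_coeff f (n div int N) else 0)"
    using exp1 q_expansion_change_width[OF N] by (simp add: slash_I)
  hence "(if int N dvd 0 then fourier_coeff f (0 div int N) else 0) = 0"
    using f I unfolding weakly_holomorphic_cusp_forms_def by blast
  thus "fourier_coeff f 0 = 0" by simp
qed

section \<open>The L-series as an integral\<close>

text \<open>Integration of the Fourier expansion term by term. Along the segment \<open>Im z = 1\<close>, so the
  \<open>n\<close>-th term has the same modulus everywhere, and the absolute convergence at \<open>\<i>\<close> dominates it.\<close>

lemma has_sum_expint_contour_integral:
  assumes exp1: "q_expansion 1 f c" and w: "Im w > 0"
  shows "((\<lambda>n. c n * (\<i> powr (1 - a) * expint a (2 * of_real pi * of_int n + w))) has_sum
           contour_integral (linepath \<i> (\<i> + 1))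
             (\<lambda>z. f z * exp (\<i> * w * z) * lerch_zeta a (w / (2 * of_real pi)) z)) UNIV"
proof -
  define K where "K z = exp (\<i> * w * z) * lerch_zeta a (w / (2 * of_real pi)) z" for z
  define S where "S = closed_segment \<i> (\<i> + 1)"
  let ?e = "\<lambda>n z. exp (2 * of_real pi * \<i> * of_int n * z) :: complex"
  let ?I = "\<lambda>n. \<i> powr (1 - a) * expint a (2 * of_real pi * of_int n + w)"
  have S: "Re z \<ge> 0" "Im z = 1" if "z \<in> S" for z
    using that by (auto simp: S_def in_segment)
  have int: "((\<lambda>z. c n * ?e n z * K z) has_contour_integral c n * ?I n) (linepath \<i> (\<i> + 1))" for n
  proof -
    have "lerch_zeta a ((2 * of_real pi * of_int n + w) / (2 * of_real pi)) z
            = lerch_zeta a (w / (2 * of_real pi)) z" for z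
      using lerch_zeta_plus_of_int[of a "w / (2 * of_real pi)" n z] by (simp add: add_divide_distrib add.commute)
    moreover have "exp (\<i> * (2 * of_real pi * of_int n + w) * z) = ?e n z * exp (\<i> * w * z)" for z
      by (simp add: ring_distribs exp_add mult_ac)
    ultimately have "((\<lambda>z. ?e n z * K z) has_contour_integral ?I n) (linepath \<i> (\<i> + 1))"
      using has_contour_integral_exp_lerch_zeta[of "2 * of_real pi * of_int n + w" a] w
      by (simp add: K_def mult.assoc)
    from has_contour_integral_lmul[OF this, of "c n"] show ?thesis by (simp only: mult.assoc)
  qed
  have "continuous_on S K"
    unfolding K_def using w S
    by (intro continuous_intros continuous_on_lerch_zeta) (auto simp: S_def bounded_closed_segment)
  hence "bounded (K ` S)"
    by (intro compact_imp_bounded compact_continuous_image) (simp_all add: S_def)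
  then obtain B where B: "\<And>z. z \<in> S \<Longrightarrow> norm (K z) \<le> B" by (auto simp: bounded_iff)
  have fourier: "((\<lambda>n. c n * ?e n z) has_sum f z) UNIV" if "Im z > 0" for z
    using exp1 that by (auto simp: q_expansion_def upper_half_plane_def)
  have "(\<lambda>n. norm (c n * ?e n \<i>)) summable_on UNIV"
    using fourier[of \<i>] summable_on_iff_abs_summable_on_complex has_sum_imp_summable by fastforce
  hence "(\<lambda>n. norm (c n * ?e n \<i>) * B) summable_on UNIV"
    by (rule summable_on_cmult_left)
  hence "uniform_limit S (\<lambda>X z. \<Sum>n\<in>X. c n * ?e n z * K z) (\<lambda>z. \<Sum>\<^sub>\<infinity>n. c n * ?e n z * K z)
           (finite_subsets_at_top UNIV)"
  proof (rule Weierstrass_m_test_general[rotated])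
    fix n z assume z: "z \<in> S"
    have "norm (c n * ?e n z) = norm (c n * ?e n \<i>)"
      using S(2)[OF z] by (simp add: norm_mult)
    thus "norm (c n * ?e n z * K z) \<le> norm (c n * ?e n \<i>) * B"
      unfolding norm_mult[of _ "K z"] using B[OF z] by (simp add: mult_left_mono)
  qed
  hence "uniform_limit S (\<lambda>X z. \<Sum>n\<in>X. c n * ?e n z * K z) (\<lambda>z. f z * K z) (finite_subsets_at_top UNIV)"
  proof (rule uniform_limit_cong'[THEN iffD1, rotated 2])
    fix z assume "z \<in> S"
    hence "((\<lambda>n. c n * ?e n z * K z) has_sum f z * K z) UNIV"
      using S by (intro has_sum_cmult_left fourier) auto
    thus "(\<Sum>\<^sub>\<infinity>n. c n * ?e n z * K z) = f z * K z" by (rule infsumI)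
  qed auto
  hence "((\<lambda>X. contour_integral (linepath \<i> (\<i> + 1)) (\<lambda>z. \<Sum>n\<in>X. c n * ?e n z * K z)) \<longlongrightarrow>
           contour_integral (linepath \<i> (\<i> + 1)) (\<lambda>z. f z * K z)) (finite_subsets_at_top UNIV)"
    by (intro contour_integral_uniform_limit(2)[where B = 1] eventually_finite_subsets_at_top_weakI)
       (auto simp: S_def intro!: has_contour_integral_integrable[OF has_contour_integral_sum[OF _ int]])
  moreover have "eventually (\<lambda>X. contour_integral (linepath \<i> (\<i> + 1)) (\<lambda>z. \<Sum>n\<in>X. c n * ?e n z * K z)
                   = (\<Sum>n\<in>X. c n * ?I n)) (finite_subsets_at_top UNIV)"
    by (intro eventually_finite_subsets_at_top_weakI contour_integral_unique has_contour_integral_sum int)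
  ultimately show ?thesis
    unfolding has_sum_def K_def by (simp add: Lim_transform_eventually mult.assoc)
qed

theorem theorem1p1:
  fixes k :: int and N :: nat and f :: "complex \<Rightarrow> complex" and s :: real and w :: complex
  assumes "N \<ge> 1"
    and "f \<in> weakly_holomorphic_cusp_forms k N"
    and "Im w > 0"
  shows "L_phi_term f (of_real s) w summable_on {n. n \<noteq> 0} \<and>
         L_phi f (of_real s) w =
           \<i> powr (- of_real s) *
           contour_integral (linepath \<i> (\<i> + 1))
             (\<lambda>z. f z * exp (\<i> * w * z) * lerch_zeta (1 - of_real s) (w / (2 * of_real pi)) z)"
proof -
  let ?J = "contour_integral (linepath \<i> (\<i> + 1))
             (\<lambda>z. f z * exp (\<i> * w * z) * lerch_zeta (1 - of_real s) (w / (2 * of_real pi)) z)"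
  note coeff = fourier_coeff_cusp_form[OF assms(1,2)]
  have cancel: "\<i> powr (- of_real s) * \<i> powr (of_real s) = 1"
    by (simp add: powr_minus)
  have "((\<lambda>n. \<i> powr (- of_real s) * (fourier_coeff f n *
            (\<i> powr (1 - (1 - of_real s)) * expint (1 - of_real s) (2 * of_real pi * of_int n + w))))
          has_sum \<i> powr (- of_real s) * ?J) UNIV"
    by (intro has_sum_cmult_right has_sum_expint_contour_integral coeff assms)
  moreover have "\<i> powr (- of_real s) * (fourier_coeff f n *
            (\<i> powr (1 - (1 - of_real s)) * expint (1 - of_real s) (2 * of_real pi * of_int n + w)))
            = L_phi_term f (of_real s) w n" for n
    using cancel by (simp add: L_phi_term_def mult.left_commute[of "fourier_coeff f n"] flip: mult.assoc)
  ultimately have "(L_phi_term f (of_real s) w has_sum \<i> powr (- of_real s) * ?J) UNIV"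
    by simp
  hence "(L_phi_term f (of_real s) w has_sum \<i> powr (- of_real s) * ?J) {n. n \<noteq> 0}"
    by (subst has_sum_cong_neutral[where T = UNIV and g = "L_phi_term f (of_real s) w"])
       (auto simp: L_phi_term_def coeff)
  thus ?thesis
    unfolding L_phi_def by (auto intro: has_sum_imp_summable infsumI)
qed

end
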